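(* Let $\mathbb{K}$ be a field of characteristic $0$, let $\mathbb{F}$ be $\mathbb{K}[x]$ or $\mathbb{K}(x)$ with derivation $\partial/\partial x$, and let $\alpha\in\{+,-,\times,/\}$. Let $p\in\mathbb{F}[y^{(\infty)}]$ and $q\in\mathbb{F}[z^{(\infty)}]$ be differential polynomials of order $n$ and $m$, respectively (not necessarily linear in their highest order terms). Then $$\mathfrak{o}_{\alpha}(p,q)\;\le\; m+n+2,$$ where $\mathfrak{o}_\alpha(p,q)$ is the minimal order of a non-zero differential polynomial in $w$ that can be derived from the dynamical model for $\alpha$ built from $p$ and $q$ (defined in the context).
   Context: Differential polynomials: $\mathbb{F}[y^{(\infty)}]=\mathbb{F}[y,y',y'',\ldots]$ is the polynomial ring in infinitely many variables $y^{(j)}$ ($j\in\mathbb{N}$, $y^{(0)}=y$) with the derivation extending that of $\mathbb{F}$ and satisfying $(y^{(j)})'=y^{(j+1)}$; similarly for several differential indeterminates. The order of a non-zero differential polynomial is the largest $n$ such that $y^{(n)}$ occurs in it. A differential polynomial $p$ of order $n$ is linear in its highest order term (l.h.o.) if $y^{(n)}$ appears only linearly in $p$, i.e. $p$ has degree $1$ in $y^{(n)}$. In that case, the equation $p=0$ can be solved for $y^{(n)}$, giving $y^{(n)}=r_p(x,y,\ldots,y^{(n-1)})$ with $r_p$ a rational function over $\mathbb{K}$. If $p$ is not l.h.o., its derivative $p'$ is l.h.o. and has order $n+1$. For a set $S$ of differential polynomials, $\langle S\rangle^{(\infty)}$ is the ideal generated by all elements of $S$ and all their derivatives. For an ideal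 $I$ of a ring $R$ and $s\in R$, $I:s^\infty=\{r\in R\mid \exists k\in\mathbb{N}: s^k r\in I\}$. Dynamical model: a system $\mathcal{M}$ of the form $u_i'=A_i(u_1,\ldots,u_N)$ $(1\le i\le N)$, $w=B(u_1,\ldots,u_N)$, with $A_i,B\in\mathbb{K}(x)(u_1,\ldots,u_N)$. Let $Q$ be the common denominator of the system and write $A_i=a_i/Q$, $B=b/Q$ with $a_i,b,Q\in\mathbb{K}(x)[u_1,\ldots,u_N]$. Put $$I_{\mathcal{M}}=\langle Qu_1'-a_1,\ldots,Qu_N'-a_N,\;Qw-b\rangle^{(\infty)}:Q^\infty\;\subset\;\mathbb{K}(x)[u_1^{(\infty)},\ldots,u_N^{(\infty)},w^{(\infty)}].$$ The differential polynomials in $w$ derived from $\mathcal{M}$ are the elements of $I_{\mathcal{M}}\cap\mathbb{K}(x)[w^{(\infty)}]$. The model for $\alpha$ built from $p$ and $q$: let $p_1=p$ if $p$ is l.h.o. and $p_1=p'$ otherwise; let $q_1=q$ if $q$ is l.h.o. and $q_1=q'$ otherwise. Let $n_1,m_1$ be the orders of $p_1,q_1$, and let $r_{p_1},r_{q_1}$ be the rational functions with $y^{(n_1)}=r_{p_1}(x,y,\ldots,y^{(n_1-1)})$ and $z^{(m_1)}=r_{q_1}(x,z,\ldots,z^{(m_1-1)})$. The model is the system in the $n_1+m_1$ indeterminates $u_1=y,\ldots,u_{n_1}=y^{(n_1-1)}$, $u_{n_1+1}=z,\ldots,u_{n_1+m_1}=z^{(m_1-1)}$ given by $$u_i'=u_{i+1}\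 (1\le i\le n_1-1),\quad u_{n_1}'=r_{p_1}(x,u_1,\ldots,u_{n_1}),$$ $$u_{n_1+i}'=u_{n_1+i+1}\ (1\le i\le m_1-1),\quad u_{n_1+m_1}'=r_{q_1}(x,u_{n_1+1},\ldots,u_{n_1+m_1}),$$ $$w=\alpha(u_1,u_{n_1+1}).$$ (If $n_1=0$ there are no state variables for $y$, and $u_1$ in the last equation is read as $y=r_{p_1}(x)$; similarly, if $m_1=0$, $u_{n_1+1}$ is read as $z=r_{q_1}(x)$, where for $\alpha=/$ one needs $r_{q_1}\neq0$ for the model to be defined.) Finally, $\mathfrak{o}_\alpha(p,q)$ is the minimal order of a non-zero element of $I_{\mathcal{M}}\cap\mathbb{K}(x)[w^{(\infty)}]$ for this model $\mathcal{M}$. *)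

theory Defs
  imports
    "HOL-Computational_Algebra.Polynomial"
    "HOL-Computational_Algebra.Fraction_Field"
    "HOL-Library.Poly_Mapping"
    "HOL-Library.Extended_Nat"
begin

section \<open>Polynomials in arbitrarily many variables\<close>

text \<open>
  A polynomial over \<open>'c\<close> with variables from \<open>'v\<close> is a finitely supported map from exponent vectors
  to coefficients. A polynomial ring in a smaller set \<open>V\<close> of variables is the subring of all \<open>f\<close>
  with \<open>vars f \<subseteq> V\<close>.
\<close>

type_synonym ('v, 'c) mpoly = "('v \<Rightarrow>\<^sub>0 nat) \<Rightarrow>\<^sub>0 'c"

definition Const :: "'c \<Rightarrow> ('v, 'c::zero) mpoly"
  where "Const c = Poly_Mapping.single 0 c"

definition Var :: "'v \<Rightarrow> ('v, 'c::zero_neq_one) mpoly"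
  where "Var v = Poly_Mapping.single (Poly_Mapping.single v 1) 1"

definition vars :: "('v, 'c::zero) mpoly \<Rightarrow> 'v set"
  where "vars f = (\<Union>t\<in>Poly_Mapping.keys f. Poly_Mapping.keys t)"

definition degree_in :: "'v \<Rightarrow> ('v, 'c::zero) mpoly \<Rightarrow> nat"
  where "degree_in v f = Max (insert 0 ((\<lambda>t. Poly_Mapping.lookup t v) ` Poly_Mapping.keys f))"

text \<open>The coefficient of \<open>v ^ k\<close> when \<open>f\<close> is read as a univariate polynomial in \<open>v\<close>; it does not
  involve \<open>v\<close>.\<close>

definition coeff_in :: "'v \<Rightarrow> nat \<Rightarrow> ('v, 'c::comm_monoid_add) mpoly \<Rightarrow> ('v, 'c) mpoly"
  where "coeff_in v k f =
    (\<Sum>t\<in>{t \<in> Poly_Mapping.keys f. Poly_Mapping.lookup t v = k}.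
       Poly_Mapping.single (t - Poly_Mapping.single v k) (Poly_Mapping.lookup f t))"

text \<open>Substitution of \<open>g v\<close> for each variable \<open>v\<close>, with \<open>h\<close> applied to the coefficients.\<close>

definition subst :: "('c::zero \<Rightarrow> 'r) \<Rightarrow> ('v \<Rightarrow> 'r) \<Rightarrow> ('v, 'c) mpoly \<Rightarrow> 'r::comm_semiring_1"
  where "subst h g f =
    (\<Sum>t\<in>Poly_Mapping.keys f.
       h (Poly_Mapping.lookup f t) * (\<Prod>v\<in>Poly_Mapping.keys t. g v ^ Poly_Mapping.lookup t v))"


section \<open>The differential field of rational functions\<close>

text \<open>\<open>'k ratx\<close> is the field \<open>K(x)\<close>, where \<open>K\<close> is the type \<open>'k\<close>.\<close>

type_synonym 'k ratx = "'k poly fract"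

lift_definition rat_deriv :: "'k::{idom, semiring_char_0} ratx \<Rightarrow> 'k ratx"
  is "\<lambda>(a, b). (pderiv a * b - a * pderiv b, b * b)"
proof (clarsimp, goal_cases)
  case (1 a b c d)
  then have eq: "a * d = c * b" by simp
  then have "pderiv (a * d) = pderiv (c * b)" by simp
  then have eq': "a * pderiv d + d * pderiv a = c * pderiv b + b * pderiv c"
    by (simp add: pderiv_mult)
  have "(pderiv a * b - a * pderiv b) * (d * d) - (pderiv c * d - c * pderiv d) * (b * b)
      = b * d * (a * pderiv d + d * pderiv a - (c * pderiv b + b * pderiv c))
        - (a * d - c * b) * (d * pderiv b + b * pderiv d)"
    by (simp add: algebra_simps)
  also have "\<dots> = 0" using eq eq' by simp
  finally show ?case by simp
qed

lemma rat_deriv_Fract: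
  "b \<noteq> 0 \<Longrightarrow> rat_deriv (Fract a b) = Fract (pderiv a * b - a * pderiv b) (b * b)"
  by transfer simp

lemma rat_deriv_add: "rat_deriv (f + g) = rat_deriv f + rat_deriv g"
  by (cases f, cases g)
     (simp add: rat_deriv_Fract eq_fract pderiv_add pderiv_mult algebra_simps)

lemma rat_deriv_mult: "rat_deriv (f * g) = rat_deriv f * g + f * rat_deriv g"
  by (cases f, cases g)
     (simp add: rat_deriv_Fract eq_fract pderiv_mult algebra_simps)


section \<open>Differential polynomials\<close>

text \<open>The variable \<open>(i, j)\<close> is the \<open>j\<close>-th derivative of the differential indeterminate \<open>i\<close>.\<close>

type_synonym ('i, 'k) dpoly = "('i \<times> nat, 'k ratx) mpoly"

definition succ_var :: "'i \<times> nat \<Rightarrow> 'i \<times> nat"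
  where "succ_var v = (fst v, Suc (snd v))"

text \<open>The derivative of the single term \<open>c t\<close>: it is \<open>c' t + c t'\<close>, with \<open>t'\<close> given by the product rule.\<close>

definition mderiv :: "('i \<times> nat \<Rightarrow>\<^sub>0 nat) \<Rightarrow> 'k::{idom, semiring_char_0} ratx \<Rightarrow> ('i, 'k) dpoly"
  where "mderiv t c =
       Poly_Mapping.single t (rat_deriv c) +
       (\<Sum>v\<in>Poly_Mapping.keys t.
          Poly_Mapping.single
            (t - Poly_Mapping.single v 1 + Poly_Mapping.single (succ_var v) 1)
            (of_nat (Poly_Mapping.lookup t v) * c))"

definition dderiv :: "('i, 'k::{idom, semiring_char_0}) dpoly \<Rightarrow> ('i, 'k) dpoly"
  where "dderiv f = (\<Sum>t\<in>Poly_Mapping.keys f. mderiv t (Poly_Mapping.lookup f t))"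

lemma rat_deriv_0: "rat_deriv 0 = 0"
  by (simp add: Zero_fract_def rat_deriv_Fract eq_fract)

lemma rat_deriv_1: "rat_deriv 1 = 0"
  by (simp add: One_fract_def Zero_fract_def rat_deriv_Fract eq_fract)

lemma mderiv_0 [simp]: "mderiv t 0 = 0"
  by (simp add: mderiv_def rat_deriv_0)

lemma mderiv_add: "mderiv t (c + d) = mderiv t c + mderiv t d"
  by (simp add: mderiv_def rat_deriv_add single_add sum.distrib distrib_left algebra_simps)

lemma dderiv_superset:
  assumes "finite A" "Poly_Mapping.keys f \<subseteq> A"
  shows "dderiv f = (\<Sum>t\<in>A. mderiv t (Poly_Mapping.lookup f t))"
  unfolding dderiv_def using assms
  by (intro sum.mono_neutral_left) (auto simp: in_keys_iff)

lemma dderiv_add: "dderiv (f + g) = dderiv f + dderiv g"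
proof -
  let ?A = "Poly_Mapping.keys f \<union> Poly_Mapping.keys g"
  have "dderiv (f + g) = (\<Sum>t\<in>?A. mderiv t (Poly_Mapping.lookup (f + g) t))"
    by (rule dderiv_superset) (use Poly_Mapping.keys_add[of f g] in auto)
  also have "\<dots> = (\<Sum>t\<in>?A. mderiv t (Poly_Mapping.lookup f t)) + (\<Sum>t\<in>?A. mderiv t (Poly_Mapping.lookup g t))"
    by (simp add: lookup_add mderiv_add sum.distrib)
  also have "\<dots> = dderiv f + dderiv g"
    by (simp add: dderiv_superset[where A = ?A])
  finally show ?thesis .
qed

lemma dderiv_zero [simp]: "dderiv 0 = 0" by (simp add: dderiv_def)

lemma dderiv_sum: "dderiv (sum f A) = (\<Sum>x\<in>A. dderiv (f x))"
  by (induction A rule: infinite_finite_induct) (auto simp: dderiv_add)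

lemma dderiv_single: "dderiv (Poly_Mapping.single t c) = mderiv t c"
  by (cases "c = 0") (simp_all add: dderiv_def)

lemma poly_mapping_eq_sum_single:
  "f = (\<Sum>t\<in>Poly_Mapping.keys f. Poly_Mapping.single t (Poly_Mapping.lookup f t))"
  by (rule poly_mapping_eqI)
     (auto simp: lookup_sum lookup_single when_def sum.delta in_keys_iff)

lemma mderiv_superset:
  assumes "finite A" "Poly_Mapping.keys t \<subseteq> A"
  shows "mderiv t c = Poly_Mapping.single t (rat_deriv c) +
       (\<Sum>v\<in>A. Poly_Mapping.single
            (t - Poly_Mapping.single v 1 + Poly_Mapping.single (succ_var v) 1)
            (of_nat (Poly_Mapping.lookup t v) * c))"
  unfolding mderiv_def using assms
  by (intro arg_cong2[where f = "(+)"] refl sum.mono_neutral_left) (auto simp: in_keys_iff)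

lemma minus_single_add:
  fixes s t :: "'a \<Rightarrow>\<^sub>0 nat"
  assumes "Poly_Mapping.lookup s v \<noteq> 0"
  shows "s + t - Poly_Mapping.single v 1 = s - Poly_Mapping.single v 1 + t"
  using assms by (intro poly_mapping_eqI) (auto simp: lookup_add lookup_minus lookup_single when_def)

lemma minus_single_add':
  fixes s t :: "'a \<Rightarrow>\<^sub>0 nat"
  assumes "Poly_Mapping.lookup s v \<noteq> 0"
  shows "t + s - Poly_Mapping.single v 1 = t + (s - Poly_Mapping.single v 1)"
  using minus_single_add[OF assms, of t] by (simp add: add.commute)

lemma mderiv_mult:
  "mderiv (s + t) (c * d) = mderiv s c * Poly_Mapping.single t d + Poly_Mapping.single s c * mderiv t d"
proof -
  let ?A = "Poly_Mapping.keys s \<union> Poly_Mapping.keys t"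
  let ?m = "\<lambda>t v. t - Poly_Mapping.single v 1 + Poly_Mapping.single (succ_var v) (1::nat)"
  have *: "Poly_Mapping.single (?m (s + t) v) (of_nat (Poly_Mapping.lookup (s + t) v) * (c * d)) =
     Poly_Mapping.single (?m s v) (of_nat (Poly_Mapping.lookup s v) * c) * Poly_Mapping.single t d +
     Poly_Mapping.single s c * Poly_Mapping.single (?m t v) (of_nat (Poly_Mapping.lookup t v) * d)" for v
  proof -
    have 1: "Poly_Mapping.single (?m (s + t) v) (of_nat (Poly_Mapping.lookup s v) * (c * d)) =
       Poly_Mapping.single (?m s v + t) (of_nat (Poly_Mapping.lookup s v) * (c * d))"
      by (cases "Poly_Mapping.lookup s v = 0")
         (simp_all add: minus_single_add[of s v t, unfolded One_nat_def] add_ac)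
    have 2: "Poly_Mapping.single (?m (s + t) v) (of_nat (Poly_Mapping.lookup t v) * (c * d)) =
       Poly_Mapping.single (s + ?m t v) (of_nat (Poly_Mapping.lookup t v) * (c * d))"
      by (cases "Poly_Mapping.lookup t v = 0")
         (simp_all add: minus_single_add'[of t v s, unfolded One_nat_def] add_ac)
    show ?thesis
      unfolding lookup_add of_nat_add distrib_right single_add 1 2
      by (simp only: mult_single mult_ac add_ac)
  qed
  have k: "Poly_Mapping.keys (s + t) \<subseteq> ?A" using Poly_Mapping.keys_add[of s t] by auto
  have "mderiv (s + t) (c * d) = Poly_Mapping.single (s + t) (rat_deriv (c * d)) +
     (\<Sum>v\<in>?A. Poly_Mapping.single (?m (s + t) v) (of_nat (Poly_Mapping.lookup (s + t) v) * (c * d)))"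
    by (rule mderiv_superset) (use k in auto)
  also have "\<dots> = mderiv s c * Poly_Mapping.single t d + Poly_Mapping.single s c * mderiv t d"
    unfolding * sum.distrib
    by (subst (1 2) mderiv_superset[where A = ?A])
       (simp_all add: rat_deriv_mult single_add mult_single distrib_left distrib_right
          sum_distrib_left sum_distrib_right add_ac)
  finally show ?thesis .
qed

lemma dderiv_mult: "dderiv (f * g) = dderiv f * g + f * dderiv g"
proof -
  let ?s = "\<lambda>f t. Poly_Mapping.single t (Poly_Mapping.lookup f t)"
  have "dderiv (f * g) = dderiv ((\<Sum>s\<in>Poly_Mapping.keys f. ?s f s) * (\<Sum>t\<in>Poly_Mapping.keys g. ?s g t))"
    by (simp flip: poly_mapping_eq_sum_single)
  also have "\<dots> = (\<Sum>s\<in>Poly_Mapping.keys f. \<Sum>t\<in>Poly_Mapping.keys g.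
      mderiv s (Poly_Mapping.lookup f s) * ?s g t + ?s f s * mderiv t (Poly_Mapping.lookup g t))"
    by (simp add: sum_product dderiv_sum mult_single dderiv_single mderiv_mult)
  also have "\<dots> = dderiv f * (\<Sum>t\<in>Poly_Mapping.keys g. ?s g t) + (\<Sum>s\<in>Poly_Mapping.keys f. ?s f s) * dderiv g"
    by (simp add: sum.distrib sum_product dderiv_def)
  finally show ?thesis
    by (simp flip: poly_mapping_eq_sum_single)
qed

text \<open>The facts \<open>dderiv_add\<close>, \<open>dderiv_mult\<close>, \<open>dderiv_Const\<close> and \<open>dderiv_Var\<close> characterise the derivation.\<close>

lemma dderiv_Const: "dderiv (Const c) = Const (rat_deriv c)"
  by (simp add: Const_def dderiv_single mderiv_def)

lemma dderiv_Var: "dderiv (Var (i, j)) = Var (i, Suc j)"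
  by (simp add: Var_def dderiv_single mderiv_def succ_var_def rat_deriv_1)

text \<open>A differential polynomial not involving \<open>i\<close> has no order in \<open>i\<close>.\<close>

definition has_order :: "'i \<Rightarrow> ('i, 'k::idom) dpoly \<Rightarrow> nat \<Rightarrow> bool"
  where "has_order i f n \<longleftrightarrow> (i, n) \<in> vars f \<and> (\<forall>j. (i, j) \<in> vars f \<longrightarrow> j \<le> n)"

definition dorder :: "'i \<Rightarrow> ('i, 'k::idom) dpoly \<Rightarrow> nat"
  where "dorder i f = (THE n. has_order i f n)"

text \<open>Differential polynomials in one indeterminate have \<open>'i = unit\<close>.\<close>

definition lho :: "(unit, 'k::idom) dpoly \<Rightarrow> bool"
  where "lho f \<longleftrightarrow> degree_in ((), dorder () f) f = 1"

definition make_lho :: "(unit, 'k::{idom, semiring_char_0}) dpoly \<Rightarrow> (unit, 'k) dpoly"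
  where "make_lho f = (if lho f then f else dderiv f)"

definition ideal_gen :: "'r set \<Rightarrow> 'r set \<Rightarrow> 'r::comm_ring_1 set"
  where "ideal_gen R S = {\<Sum>s\<in>T. c s * s | c T. finite T \<and> T \<subseteq> S \<and> c ` T \<subseteq> R}"

definition diff_ideal_gen ::
    "('i, 'k::{idom, semiring_char_0}) dpoly set \<Rightarrow> ('i, 'k) dpoly set \<Rightarrow> ('i, 'k) dpoly set"
  where "diff_ideal_gen R S = ideal_gen R {(dderiv ^^ k) s | k s. s \<in> S}"

definition saturation :: "'r set \<Rightarrow> 'r set \<Rightarrow> 'r \<Rightarrow> 'r::comm_ring_1 set"
  where "saturation R I s = {r \<in> R. \<exists>k. s ^ k * r \<in> I}"


section \<open>Dynamical models\<close>

text \<open>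
  \<open>'k ratfun\<close> is the field of rational functions over \<open>K(x)\<close> in \<open>u\<^sub>0, u\<^sub>1, \<dots>\<close>. State variables are
  numbered from \<open>0\<close>: a model with \<open>N\<close> states uses \<open>u\<^sub>0, \<dots>, u\<^bsub>N-1\<^esub>\<close>.
\<close>

type_synonym 'k ratfun = "(nat, 'k ratx) mpoly fract"

record (overloaded) 'k model =
  states :: nat
  rhs :: "nat \<Rightarrow> 'k ratfun"
  out :: "'k ratfun"

text \<open>\<open>Q\<close> is a common denominator when every \<open>A\<^sub>i\<close> (\<open>i < N\<close>) and \<open>B\<close> has the form \<open>a / Q\<close>
  with \<open>a\<close> a polynomial in the state variables. The numerator \<open>a\<close> is then unique.\<close>

definition common_denominator :: "'k::idom model \<Rightarrow> (nat, 'k ratx) mpoly \<Rightarrow> bool"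
  where "common_denominator M Q \<longleftrightarrow>
    Q \<noteq> 0 \<and> vars Q \<subseteq> {..<states M} \<and>
    (\<forall>A \<in> insert (out M) (rhs M ` {..<states M}).
       \<exists>a. vars a \<subseteq> {..<states M} \<and> A = Fract a Q)"

datatype indet = U nat | W

definition state_poly :: "(nat, 'k::idom ratx) mpoly \<Rightarrow> (indet, 'k) dpoly"
  where "state_poly = subst Const (\<lambda>i. Var (U i, 0))"

definition model_ring :: "'k::idom model \<Rightarrow> (indet, 'k) dpoly set"
  where "model_ring M = {f. vars f \<subseteq> (U ` {..<states M} \<union> {W}) \<times> UNIV}"

definition w_ring :: "(indet, 'k::idom) dpoly set"
  where "w_ring = {f. vars f \<subseteq> {W} \<times> UNIV}"

text \<open>The ideal does not depend on the choice of the common denominator \<open>Q\<close>: it is the kernel of the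
  differential homomorphism into \<open>K(x)(u\<^sub>0, \<dots>, u\<^bsub>N-1\<^esub>)\<close> with the derivation given by the model,
  fixing every \<open>u\<^sub>i\<close> and sending \<open>w\<close> to \<open>B\<close>. Results are stated for every \<open>Q\<close>.\<close>

definition model_ideal ::
    "'k::{idom, semiring_char_0} model \<Rightarrow> (nat, 'k ratx) mpoly \<Rightarrow> (indet, 'k) dpoly set"
  where "model_ideal M Q =
    saturation (model_ring M)
      (diff_ideal_gen (model_ring M)
        ({state_poly Q * Var (U i, 1) - state_poly a | i a. i < states M \<and> rhs M i = Fract a Q} \<union>
         {state_poly Q * Var (W, 0) - state_poly b | b. out M = Fract b Q}))
      (state_poly Q)"

text \<open>The value is \<open>\<infinity>\<close> if there is no non-zero differential polynomial in \<open>w\<close> in the ideal.\<close>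

definition min_order :: "'k::{idom, semiring_char_0} model \<Rightarrow> (nat, 'k ratx) mpoly \<Rightarrow> enat"
  where "min_order M Q =
    Inf {enat k | k f. f \<in> model_ideal M Q \<inter> w_ring \<and> f \<noteq> 0 \<and> has_order W f k}"


section \<open>The model built from two differential polynomials\<close>

definition state :: "nat \<Rightarrow> 'k::idom ratfun"
  where "state i = Fract (Var i) 1"

text \<open>
  If \<open>f = S y\<^bsup>(n)\<^esup> + T\<close> is l.h.o. of order \<open>n\<close>, this is \<open>- T / S\<close> with
  \<open>y\<^bsup>(j)\<^esup>\<close> replaced by the state variable with index \<open>d + j\<close>.
\<close>

definition solve_lho :: "nat \<Rightarrow> (unit, 'k::idom) dpoly \<Rightarrow> 'k ratfun"
  where "solve_lho d f =
    (let ev = subst (\<lambda>c. Fract (Const c) 1) (\<lambda>v. state (d + snd v)); v = ((), dorder () f)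
     in - ev (coeff_in v 0 f) / ev (coeff_in v 1 f))"

definition arith_model ::
    "('k ratfun \<Rightarrow> 'k ratfun \<Rightarrow> 'k ratfun) \<Rightarrow>
     (unit, 'k) dpoly \<Rightarrow> (unit, 'k) dpoly \<Rightarrow> 'k::{idom, semiring_char_0} model"
  where "arith_model \<alpha> p q =
    (let p1 = make_lho p; q1 = make_lho q; n1 = dorder () p1; m1 = dorder () q1;
         rp = solve_lho 0 p1; rq = solve_lho n1 q1
     in \<lparr>states = n1 + m1,
         rhs = (\<lambda>i. if Suc i = n1 then rp else if Suc i = n1 + m1 then rq else state (Suc i)),
         out = \<alpha> (if n1 = 0 then rp else state 0) (if m1 = 0 then rq else state n1)\<rparr>)"

text \<open>Division by \<open>z\<close> is meaningful unless \<open>z\<close> is not a state variable and equals the zero function.\<close>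

definition arith_model_defined ::
    "('k ratfun \<Rightarrow> 'k ratfun \<Rightarrow> 'k ratfun) \<Rightarrow>
     (unit, 'k) dpoly \<Rightarrow> (unit, 'k::{idom, semiring_char_0}) dpoly \<Rightarrow> bool"
  where "arith_model_defined \<alpha> p q \<longleftrightarrow>
    (\<alpha> = (/) \<and> dorder () (make_lho q) = 0 \<longrightarrow>
       solve_lho (dorder () (make_lho p)) (make_lho q) \<noteq> 0)"

end

theory Submission
  imports Defs "HOL-Library.FuncSet"
begin

text \<open>
  Modulo the differential ideal of a model with \<open>N\<close> states, every derivative \<open>w\<^sup>(\<^sup>j\<^sup>)\<close>, multiplied by a
  power of \<open>Q\<close>, is a polynomial in the \<open>N\<close> state variables. The \<open>N + 1\<close> fractions obtained for
  \<open>j = 0, \<dots>, N\<close> are algebraically dependent over \<open>K(x)\<close>, and a relation between them, read as a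
  differential polynomial in \<open>w\<close>, lies in the saturated ideal and has order at most \<open>N\<close>. The model
  for \<open>\<alpha>\<close> has at most \<open>(n + 1) + (m + 1)\<close> states, because differentiating raises the order by one.
\<close>

section \<open>Variables and monomial expansions of polynomials\<close>

lemma vars_zero [simp]: "vars 0 = {}"
  by (simp add: vars_def)

lemma vars_one [simp]: "vars 1 = {}"
  by (simp add: vars_def)

lemma vars_Const [simp]: "vars (Const c) = {}"
  by (auto simp: vars_def Const_def)

lemma vars_Var [simp]: "vars (Var v :: ('v, 'c::zero_neq_one) mpoly) = {v}"
  by (simp add: vars_def Var_def)

lemma vars_uminus [simp]: "vars (- f :: ('v, 'c::ab_group_add) mpoly) = vars f"
proof -
  have "Poly_Mapping.keys (- f) = Poly_Mapping.keys f"
    by (auto simp: in_keys_iff)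
  then show ?thesis by (simp add: vars_def)
qed

lemma vars_add_subset: "vars f \<subseteq> X \<Longrightarrow> vars g \<subseteq> X \<Longrightarrow> vars (f + g) \<subseteq> X"
  using Poly_Mapping.keys_add[of f g] unfolding vars_def by blast

lemma vars_diff_subset:
  fixes f g :: "('v, 'c::ab_group_add) mpoly"
  shows "vars f \<subseteq> X \<Longrightarrow> vars g \<subseteq> X \<Longrightarrow> vars (f - g) \<subseteq> X"
  using vars_add_subset[of f X "- g"] by simp

lemma vars_mult_subset:
  fixes f g :: "('v, 'c::semiring_0) mpoly"
  assumes "vars f \<subseteq> X" "vars g \<subseteq> X"
  shows "vars (f * g) \<subseteq> X"
proof
  fix v assume "v \<in> vars (f * g)"
  then obtain s t where st: "s \<in> Poly_Mapping.keys f" "t \<in> Poly_Mapping.keys g"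
      "v \<in> Poly_Mapping.keys (s + t)"
    using Poly_Mapping.keys_mult[of f g] by (fastforce simp: vars_def)
  then have "v \<in> Poly_Mapping.keys s \<union> Poly_Mapping.keys t"
    using Poly_Mapping.keys_add[of s t] by blast
  with st assms show "v \<in> X" by (auto simp: vars_def)
qed

lemma vars_power_subset:
  fixes f :: "('v, 'c::semiring_1) mpoly"
  shows "vars f \<subseteq> X \<Longrightarrow> vars (f ^ k) \<subseteq> X"
  by (induction k) (simp_all add: vars_mult_subset)

lemma Const_1: "Const 1 = 1"
  by (simp add: Const_def)

lemma Const_add: "Const (a + b) = Const a + Const b"
  by (simp add: Const_def single_add)

lemma Const_mult: "Const (a * b :: 'c::semiring_0) = Const a * Const b"
  by (simp add: Const_def mult_single)

lemma Const_mult_single: "Const (a :: 'c::semiring_0) * Poly_Mapping.single t b = Poly_Mapping.single t (a * b)"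
  by (simp add: Const_def mult_single)

lemma Var_power: "(Var v :: ('v, 'c::comm_semiring_1) mpoly) ^ k = Poly_Mapping.single (Poly_Mapping.single v k) 1"
  by (induction k) (simp_all add: Var_def mult_single single_add[symmetric])

lemma single_eq_prod_Var:
  "Poly_Mapping.single t (1::'c::comm_semiring_1) =
     (\<Prod>v\<in>Poly_Mapping.keys t. Var v ^ Poly_Mapping.lookup t v)"
proof -
  have "(\<Prod>v\<in>A. Poly_Mapping.single (s v) (1::'c)) = Poly_Mapping.single (\<Sum>v\<in>A. s v) 1"
    if "finite A" for A :: "'a set" and s :: "'a \<Rightarrow> ('a \<Rightarrow>\<^sub>0 nat)"
    using that by (induction A) (simp_all add: mult_single)
  then show ?thesis
    by (simp add: Var_power flip: poly_mapping_eq_sum_single)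
qed

lemma mpoly_eq_sum_monomials:
  fixes f :: "('v, 'c::comm_semiring_1) mpoly"
  shows "f = (\<Sum>t\<in>Poly_Mapping.keys f. Const (Poly_Mapping.lookup f t) *
               (\<Prod>v\<in>Poly_Mapping.keys t. Var v ^ Poly_Mapping.lookup t v))"
  by (subst poly_mapping_eq_sum_single) (simp add: Const_mult_single flip: single_eq_prod_Var)

text \<open>Substitution uses only sums, products and powers of values of \<open>h\<close> and
  \<open>g\<close>. The set \<open>S\<close> is left arbitrary so that it can be instantiated with
  polynomials over a restricted set of variables.\<close>

lemma subst_closed:
  assumes add: "\<And>a b. a \<in> S \<Longrightarrow> b \<in> S \<Longrightarrow> a + b \<in> S"
    and mult: "\<And>a b. a \<in> S \<Longrightarrow> b \<in> S \<Longrightarrow> a * b \<in> S"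
    and "0 \<in> S" "1 \<in> S" "\<And>c. h c \<in> S" "\<And>v. v \<in> vars f \<Longrightarrow> g v \<in> S"
  shows "subst h g f \<in> S"
proof -
  have sum: "sum a A \<in> S" if "\<And>i. i \<in> A \<Longrightarrow> a i \<in> S" for a :: "'x \<Rightarrow> 'a" and A
    using that by (induction A rule: infinite_finite_induct) (auto simp: assms)
  have prod: "prod a A \<in> S" if "\<And>i. i \<in> A \<Longrightarrow> a i \<in> S" for a :: "'x \<Rightarrow> 'a" and A
    using that by (induction A rule: infinite_finite_induct) (auto simp: assms)
  have power: "a ^ k \<in> S" if "a \<in> S" for a k
    using that by (induction k) (auto simp: assms)
  show ?thesis
    unfolding subst_def by (intro sum mult prod power assms) (auto simp: vars_def)
qed

text \<open>Substituting every variable by itself returns \<open>f\<close>, so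
  \<open>subst_closed\<close> becomes an induction principle: a property of constants and of the
  variables of \<open>f\<close> that survives sums and products holds for \<open>f\<close>.\<close>

lemma mpoly_closed:
  fixes f :: "('v, 'c::comm_semiring_1) mpoly"
  assumes "\<And>a b. a \<in> S \<Longrightarrow> b \<in> S \<Longrightarrow> a + b \<in> S"
    and "\<And>a b. a \<in> S \<Longrightarrow> b \<in> S \<Longrightarrow> a * b \<in> S"
    and "\<And>c. Const c \<in> S" "\<And>v. v \<in> vars f \<Longrightarrow> Var v \<in> S"
  shows "f \<in> S"
proof -
  have "0 \<in> S" "1 \<in> S"
    using assms(3)[of 0] assms(3)[of 1] by (simp_all add: Const_def)
  then have "subst Const Var f \<in> S"
    by (intro subst_closed assms)
  then show ?thesis
    by (simp add: subst_def flip: mpoly_eq_sum_monomials)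
qed

lemma vars_state_poly: "vars a \<subseteq> A \<Longrightarrow> vars (state_poly a) \<subseteq> U ` A \<times> {0}"
  unfolding state_poly_def
  by (rule subst_closed[of "{f. vars f \<subseteq> U ` A \<times> {0}}", simplified mem_Collect_eq])
     (auto simp: vars_add_subset vars_mult_subset simp del: subset_iff)

section \<open>Algebraic dependence by counting monomials\<close>

text \<open>Bounding each exponent separately, rather than the total degree, makes the number of
  monomials an exact power, while the bounds still add up under multiplication.\<close>

definition exponent_box :: "'v set \<Rightarrow> nat \<Rightarrow> ('v \<Rightarrow>\<^sub>0 nat) set"
  where "exponent_box V d = {t. Poly_Mapping.keys t \<subseteq> V \<and> (\<forall>v. Poly_Mapping.lookup t v \<le> d)}"

lemma exponent_box_bij:
  assumes "finite V"
  shows "bij_betw (\<lambda>t. restrict (Poly_Mapping.lookup t) V) (exponent_box V d) (V \<rightarrow>\<^sub>E {..d})"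
  unfolding bij_betw_def
proof
  show "inj_on (\<lambda>t. restrict (Poly_Mapping.lookup t) V) (exponent_box V d)"
  proof (intro inj_onI poly_mapping_eqI)
    fix s t v
    assume st: "s \<in> exponent_box V d" "t \<in> exponent_box V d"
      "restrict (Poly_Mapping.lookup s) V = restrict (Poly_Mapping.lookup t) V"
    show "Poly_Mapping.lookup s v = Poly_Mapping.lookup t v"
    proof (cases "v \<in> V")
      case True
      with fun_cong[OF st(3), of v] show ?thesis by simp
    next
      case False
      with st(1,2) have "v \<notin> Poly_Mapping.keys s" "v \<notin> Poly_Mapping.keys t"
        by (auto simp: exponent_box_def)
      then show ?thesis by (simp add: in_keys_iff)
    qed
  qed
  show "(\<lambda>t. restrict (Poly_Mapping.lookup t) V) ` exponent_box V d = (V \<rightarrow>\<^sub>E {..d})"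
  proof (intro equalityI subsetI)
    fix f assume f: "f \<in> V \<rightarrow>\<^sub>E {..d}"
    let ?t = "Abs_poly_mapping (\<lambda>v. if v \<in> V then f v else 0)"
    have l: "Poly_Mapping.lookup ?t = (\<lambda>v. if v \<in> V then f v else 0)"
      by (rule Abs_poly_mapping_inverse) (use assms in simp)
    then have "?t \<in> exponent_box V d"
      using f by (auto simp: exponent_box_def in_keys_iff)
    moreover have "f = restrict (Poly_Mapping.lookup ?t) V"
      using f by (auto simp: l restrict_def PiE_def extensional_def)
    ultimately show "f \<in> (\<lambda>t. restrict (Poly_Mapping.lookup t) V) ` exponent_box V d"
      by blast
  qed (auto simp: exponent_box_def)
qed

lemma finite_exponent_box: "finite V \<Longrightarrow> finite (exponent_box V d)"
  using bij_betw_finite[OF exponent_box_bij[of V d]] by (simp add: finite_PiE)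

lemma card_exponent_box: "finite V \<Longrightarrow> card (exponent_box V d) = Suc d ^ card V"
  using bij_betw_same_card[OF exponent_box_bij[of V d]] by (simp add: card_PiE)

lemma exponent_box_add:
  "s \<in> exponent_box V a \<Longrightarrow> t \<in> exponent_box V b \<Longrightarrow> s + t \<in> exponent_box V (a + b)"
  using Poly_Mapping.keys_add[of s t] by (auto simp: exponent_box_def lookup_add add_mono)

lemma keys_mult_exponent_box:
  fixes f g :: "('v, 'c::semiring_0) mpoly"
  assumes "Poly_Mapping.keys f \<subseteq> exponent_box V a" "Poly_Mapping.keys g \<subseteq> exponent_box V b"
  shows "Poly_Mapping.keys (f * g) \<subseteq> exponent_box V (a + b)"
  using assms Poly_Mapping.keys_mult[of f g] by (fastforce intro: exponent_box_add)

lemma keys_one_exponent_box: "Poly_Mapping.keys (1 :: ('v, 'c::zero_neq_one) mpoly) \<subseteq> exponent_box V a"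
  by (simp add: exponent_box_def)

lemma keys_power_exponent_box:
  fixes f :: "('v, 'c::semiring_1) mpoly"
  assumes "Poly_Mapping.keys f \<subseteq> exponent_box V a"
  shows "Poly_Mapping.keys (f ^ k) \<subseteq> exponent_box V (k * a)"
  by (induction k) (simp_all add: keys_one_exponent_box keys_mult_exponent_box assms del: keys_one)

lemma keys_prod_exponent_box:
  fixes f :: "'i \<Rightarrow> ('v, 'c::comm_semiring_1) mpoly"
  assumes "finite A" "\<And>i. i \<in> A \<Longrightarrow> Poly_Mapping.keys (f i) \<subseteq> exponent_box V (d i)"
  shows "Poly_Mapping.keys (prod f A) \<subseteq> exponent_box V (sum d A)"
  using assms by (induction A) (simp_all add: keys_one_exponent_box keys_mult_exponent_box del: keys_one)

lemma exists_exponent_box: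
  assumes "finite V" "finite G" "\<And>f. f \<in> G \<Longrightarrow> vars f \<subseteq> V"
  shows "\<exists>d. \<forall>f\<in>G. Poly_Mapping.keys f \<subseteq> exponent_box V d"
proof -
  define D where "D = (\<lambda>(t, v). Poly_Mapping.lookup t v) ` ((\<Union>f\<in>G. Poly_Mapping.keys f) \<times> V)"
  have "finite D" using assms by (simp add: D_def)
  have "t \<in> exponent_box V (Max (insert 0 D))" if t: "f \<in> G" "t \<in> Poly_Mapping.keys f" for f t
  proof -
    have V: "Poly_Mapping.keys t \<subseteq> V" using t assms(3) by (auto simp: vars_def)
    \<comment> \<open>Variables outside \<open>V\<close> have exponent 0, which is why 0 is inserted
      into \<open>D\<close>.\<close>
    have "Poly_Mapping.lookup t v \<in> insert 0 D" for v
      using t V by (cases "v \<in> V") (force simp: D_def, auto simp: in_keys_iff)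
    then show ?thesis using V \<open>finite D\<close> by (auto simp: exponent_box_def intro!: Max_ge)
  qed
  then show ?thesis by blast
qed

text \<open>An independent subset of \<open>span T\<close> has at most \<open>card T\<close>
  elements. Dependence is a notion for sets, so a family that takes a value twice is treated
  separately: the difference of the two equal members is then the relation.\<close>

lemma (in vector_space) linear_relation:
  assumes "finite T" "finite I" "card T < card I" "\<And>i. i \<in> I \<Longrightarrow> v i \<in> span T"
  shows "\<exists>c. (\<exists>i\<in>I. c i \<noteq> 0) \<and> (\<Sum>i\<in>I. scale (c i) (v i)) = 0"
proof (cases "inj_on v I")
  case True
  have "dependent (v ` I)"
  proof (rule ccontr)
    assume "\<not> dependent (v ` I)"
    then have "card (v ` I) \<le> card T"
      using independent_span_bound[OF \<open>finite T\<close>] assms(4) by blast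
    with assms(3) True show False by (simp add: card_image)
  qed
  then obtain u where u: "\<exists>x\<in>v ` I. u x \<noteq> 0" "(\<Sum>x\<in>v ` I. scale (u x) x) = 0"
    using assms(2) by (auto simp: dependent_finite)
  then show ?thesis
    by (intro exI[of _ "u \<circ> v"]) (auto simp: sum.reindex[OF True])
next
  case False
  then obtain i j where ij: "i \<in> I" "j \<in> I" "i \<noteq> j" "v i = v j"
    by (auto simp: inj_on_def)
  define c where "c = (\<lambda>k. if k = i then 1 else if k = j then - 1 else 0 :: 'a)"
  have "(\<Sum>k\<in>I. scale (c k) (v k)) = (\<Sum>k\<in>{i, j}. scale (c k) (v k))"
    using ij assms(2) by (intro sum.mono_neutral_right) (auto simp: c_def)
  also have "\<dots> = 0" using ij by (simp add: c_def)
  finally show ?thesis using ij by (intro exI[of _ c]) (auto simp: c_def)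
qed

text \<open>
  The relation says that the fractions \<open>g i / h\<close> are algebraically dependent, multiplied by the
  denominator \<open>h ^ L\<close>. With all exponents \<open>e i \<le> E\<close> there are \<open>(E + 1) ^ card I\<close> monomials in the
  \<open>g i\<close>, in a space of dimension \<open>O(E ^ card V)\<close>.
\<close>

lemma algebraic_relation:
  fixes g :: "'i \<Rightarrow> ('v, 'c::field) mpoly"
  assumes V: "finite V" and I: "finite I" and card: "card V < card I"
    and h: "vars h \<subseteq> V" and g: "\<And>i. i \<in> I \<Longrightarrow> vars (g i) \<subseteq> V"
  obtains P :: "('i, 'c) mpoly" and L
  where "P \<noteq> 0" "vars P \<subseteq> I"
    and "\<And>e. e \<in> Poly_Mapping.keys P \<Longrightarrow> (\<Sum>i\<in>I. Poly_Mapping.lookup e i) \<le> L"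
    and "(\<Sum>e\<in>Poly_Mapping.keys P. Const (Poly_Mapping.lookup P e) *
           (h ^ (L - (\<Sum>i\<in>I. Poly_Mapping.lookup e i)) * (\<Prod>i\<in>I. g i ^ Poly_Mapping.lookup e i))) = 0"
proof -
  \<comment> \<open>Constants act as scalars, so the count becomes a comparison of dimensions over
    the coefficient field.\<close>
  interpret vector_space "\<lambda>c (f :: ('v, 'c) mpoly). Const c * f"
    by unfold_locales (simp_all add: algebra_simps Const_add Const_mult Const_1)
  obtain D where D: "\<forall>f\<in>insert h (g ` I). Poly_Mapping.keys f \<subseteq> exponent_box V D"
    using exists_exponent_box[of V "insert h (g ` I)"] assms by auto
  \<comment> \<open>With this choice \<open>(D * card I + 1) ^ card V\<close> is \<open>E\<close>
    itself, so \<open>T\<close> has at most \<open>E * (E + 1) ^ card V\<close> elements, fewer than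
    the \<open>(E + 1) ^ card I\<close> exponent vectors in the box.\<close>
  define E where "E = Suc (D * card I) ^ card V"
  define L where "L = card I * E"
  define T where "T = (\<lambda>t. Poly_Mapping.single t (1::'c)) ` exponent_box V (L * D)"
  define deg where "deg = (\<lambda>e. \<Sum>i\<in>I. Poly_Mapping.lookup e i :: nat)"
  define m where "m = (\<lambda>e. h ^ (L - deg e) * (\<Prod>i\<in>I. g i ^ Poly_Mapping.lookup e i))"
  have deg: "deg e \<le> L" if "e \<in> exponent_box I E" for e
    using sum_mono[of I "Poly_Mapping.lookup e" "\<lambda>_. E"] that
    by (simp add: deg_def L_def exponent_box_def)
  have "card T \<le> Suc (L * D) ^ card V"
    unfolding T_def using card_image_le[OF finite_exponent_box[OF V]] by (simp add: card_exponent_box V)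
  also have "\<dots> \<le> (Suc (D * card I) * Suc E) ^ card V"
    by (intro power_mono) (simp_all add: L_def algebra_simps)
  also have "\<dots> = E * Suc E ^ card V"
    by (simp only: power_mult_distrib E_def)
  also have "\<dots> < Suc E ^ Suc (card V)"
    by simp
  also have "\<dots> \<le> Suc E ^ card I"
    using card by (intro power_increasing) auto
  finally have card_T: "card T < card (exponent_box I E)"
    by (simp add: card_exponent_box I)
  have "m e \<in> span T" if e: "e \<in> exponent_box I E" for e
  proof -
    have "Poly_Mapping.keys (m e) \<subseteq>
        exponent_box V ((L - deg e) * D + (\<Sum>i\<in>I. Poly_Mapping.lookup e i * D))"
      unfolding m_def using D I
      by (intro keys_mult_exponent_box keys_power_exponent_box keys_prod_exponent_box) auto
    \<comment> \<open>The power of \<open>h\<close> compensates for the degree of the monomial in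
      the \<open>g i\<close>, so one bound \<open>L * D\<close> serves all \<open>e\<close>.\<close>
    also have "(L - deg e) * D + (\<Sum>i\<in>I. Poly_Mapping.lookup e i * D) = L * D"
      using deg[OF e] by (simp add: deg_def flip: sum_distrib_right add_mult_distrib)
    finally have keys: "Poly_Mapping.keys (m e) \<subseteq> exponent_box V (L * D)" .
    have "m e = (\<Sum>t\<in>Poly_Mapping.keys (m e). Const (Poly_Mapping.lookup (m e) t) * Poly_Mapping.single t 1)"
      by (subst poly_mapping_eq_sum_single) (simp add: Const_mult_single)
    also have "\<dots> \<in> span T"
      using keys by (intro span_sum span_scale span_base) (auto simp: T_def)
    finally show ?thesis .
  qed
  then obtain c where c: "\<exists>e\<in>exponent_box I E. c e \<noteq> 0"
      "(\<Sum>e\<in>exponent_box I E. Const (c e) * m e) = 0"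
    using linear_relation[of T "exponent_box I E" m] card_T
    by (auto simp: T_def finite_exponent_box V I)
  define P where "P = (\<Sum>e\<in>exponent_box I E. Poly_Mapping.single e (c e))"
  have lookup_P: "Poly_Mapping.lookup P e = (if e \<in> exponent_box I E then c e else 0)" for e
    by (simp add: P_def lookup_sum lookup_single when_def finite_exponent_box I)
  have keys_P: "Poly_Mapping.keys P \<subseteq> exponent_box I E"
    by (auto simp: in_keys_iff lookup_P split: if_splits)
  have "(\<Sum>e\<in>Poly_Mapping.keys P. Const (Poly_Mapping.lookup P e) * m e) =
      (\<Sum>e\<in>exponent_box I E. Const (Poly_Mapping.lookup P e) * m e)"
    using keys_P by (intro sum.mono_neutral_left)
      (auto simp: finite_exponent_box I in_keys_iff Const_def)
  also have "\<dots> = 0" using c(2) by (simp add: lookup_P)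
  finally have rel: "(\<Sum>e\<in>Poly_Mapping.keys P. Const (Poly_Mapping.lookup P e) * m e) = 0" .
  have "P \<noteq> 0"
  proof
    assume "P = 0"
    with lookup_P have "c e = 0" if "e \<in> exponent_box I E" for e
      using that by (metis lookup_zero)
    with c(1) show False by blast
  qed
  moreover have "vars P \<subseteq> I"
    using keys_P by (auto simp: vars_def exponent_box_def)
  ultimately show thesis
    using that[of P L] rel deg keys_P by (auto simp: m_def deg_def)
qed

section \<open>Differential ideals\<close>

lemma vars_dderiv: "vars (dderiv f) \<subseteq> vars f \<union> succ_var ` vars f"
proof -
  let ?A = "vars f" and ?B = "vars f \<union> succ_var ` vars f"
  have mono: "vars g \<subseteq> ?B" if "vars g \<subseteq> ?A" for g :: "('a, 'b) dpoly"
    using that by blast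
  \<comment> \<open>The bound on \<open>vars g\<close> is carried along because the product rule
    leaves one factor undifferentiated.\<close>
  have "f \<in> {g. vars g \<subseteq> ?A \<and> vars (dderiv g) \<subseteq> ?B}"
  proof (rule mpoly_closed)
    fix v assume "v \<in> vars f"
    then show "Var v \<in> {g. vars g \<subseteq> ?A \<and> vars (dderiv g) \<subseteq> ?B}"
      by (cases v) (force simp: dderiv_Var succ_var_def)
  qed (simp_all add: dderiv_add dderiv_mult dderiv_Const vars_add_subset vars_mult_subset mono)
  then show ?thesis by blast
qed

lemma dderiv_uminus: "dderiv (- f) = - dderiv f"
  using dderiv_add[of f "- f"] by (simp add: eq_neg_iff_add_eq_0 add.commute)

lemma dderiv_diff: "dderiv (f - g) = dderiv f - dderiv g"
  using dderiv_add[of f "- g"] by (simp add: dderiv_uminus)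

lemma dderiv_funpow_Var: "(dderiv ^^ j) (Var (i, 0)) = Var (i, j)"
  by (induction j) (simp_all add: dderiv_Var)

text \<open>
  \<open>V\<close> stands for the state variables and \<open>q\<close> for the common denominator: modulo \<open>J\<close>, multiplying by
  \<open>q\<close> brings the derivatives of the elements of \<open>V\<close> back to polynomials over \<open>V\<close>.
\<close>

locale dderiv_congruence =
  fixes X V :: "('i \<times> nat) set" and J :: "('i, 'k::field_char_0) dpoly set" and q
  assumes succ_X: "v \<in> X \<Longrightarrow> succ_var v \<in> X"
    and zero_J: "0 \<in> J"
    and add_J: "f \<in> J \<Longrightarrow> g \<in> J \<Longrightarrow> f + g \<in> J"
    and mult_J: "vars f \<subseteq> X \<Longrightarrow> g \<in> J \<Longrightarrow> f * g \<in> J"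
    and dderiv_J: "f \<in> J \<Longrightarrow> dderiv f \<in> J"
    and V_X: "V \<subseteq> X"
    and vars_q: "vars q \<subseteq> V"
    and deriv_V: "v \<in> V \<Longrightarrow> \<exists>g. vars g \<subseteq> V \<and> q * Var (succ_var v) - g \<in> J"
begin

text \<open>Both sides are required to lie over \<open>X\<close> because \<open>J\<close> absorbs
  only factors over \<open>X\<close>; this makes the relation compatible with products.\<close>

definition cong where "cong f g \<longleftrightarrow> vars f \<subseteq> X \<and> vars g \<subseteq> X \<and> f - g \<in> J"

lemma uminus_J: "f \<in> J \<Longrightarrow> - f \<in> J"
  using mult_J[of "- 1" f] by simp

lemma cong_refl: "vars f \<subseteq> X \<Longrightarrow> cong f f"
  by (simp add: cong_def zero_J)

lemma cong_trans [trans]: "cong f g \<Longrightarrow> cong g h \<Longrightarrow> cong f h"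
  using add_J[of "f - g" "g - h"] by (simp add: cong_def)

lemma cong_add: "cong f f' \<Longrightarrow> cong g g' \<Longrightarrow> cong (f + g) (f' + g')"
  using add_J[of "f - f'" "g - g'"] by (simp add: cong_def vars_add_subset add_diff_add)

lemma cong_diff: "cong f f' \<Longrightarrow> cong g g' \<Longrightarrow> cong (f - g) (f' - g')"
  using add_J[OF _ uminus_J, of "f - f'" "g - g'"]
  by (simp add: cong_def vars_diff_subset algebra_simps)

lemma cong_mult:
  assumes "cong f f'" "cong g g'"
  shows "cong (f * g) (f' * g')"
proof -
  have "f * (g - g') + g' * (f - f') \<in> J"
    using assms by (intro add_J mult_J) (simp_all add: cong_def)
  then show ?thesis
    using assms by (simp add: cong_def vars_mult_subset algebra_simps)
qed

lemma cong_power: "cong f g \<Longrightarrow> cong (f ^ k) (g ^ k)"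
  by (induction k) (simp_all add: cong_refl cong_mult)

lemma cong_sum: "(\<And>i. i \<in> A \<Longrightarrow> cong (f i) (g i)) \<Longrightarrow> cong (sum f A) (sum g A)"
  by (induction A rule: infinite_finite_induct) (simp_all add: cong_refl cong_add)

lemma cong_prod: "(\<And>i. i \<in> A \<Longrightarrow> cong (f i) (g i)) \<Longrightarrow> cong (prod f A) (prod g A)"
  by (induction A rule: infinite_finite_induct) (simp_all add: cong_refl cong_mult)

lemma vars_dderiv_X: "vars f \<subseteq> X \<Longrightarrow> vars (dderiv f) \<subseteq> X"
  using vars_dderiv[of f] succ_X by blast

lemma cong_dderiv: "cong f g \<Longrightarrow> cong (dderiv f) (dderiv g)"
  using dderiv_J[of "f - g"] by (simp add: cong_def vars_dderiv_X dderiv_diff)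

lemma vars_V_X: "vars f \<subseteq> V \<Longrightarrow> vars f \<subseteq> X"
  using V_X by blast

text \<open>A single factor \<open>q\<close> suffices whatever the degree of \<open>f\<close>, since
  \<open>q * (a * b)' = (q * a') * b + a * (q * b')\<close>. The induction also keeps track of
  \<open>vars f\<close>, as the undifferentiated factors appear in the result.\<close>

lemma ex_cong_dderiv:
  assumes "vars f \<subseteq> V"
  shows "\<exists>g. vars g \<subseteq> V \<and> cong (q * dderiv f) g"
proof -
  let ?S = "{f. vars f \<subseteq> V \<and> (\<exists>g. vars g \<subseteq> V \<and> cong (q * dderiv f) g)}"
  have "f \<in> ?S"
  proof (rule mpoly_closed)
    fix a b assume ab: "a \<in> ?S" "b \<in> ?S"
    then obtain a' b' where *: "vars a' \<subseteq> V" "cong (q * dderiv a) a'"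
        "vars b' \<subseteq> V" "cong (q * dderiv b) b'"
      by blast
    have "cong (q * dderiv (a + b)) (a' + b')"
      using cong_add[OF *(2,4)] by (simp add: dderiv_add distrib_left)
    with ab * show "a + b \<in> ?S"
      using vars_add_subset by blast
    have "cong (q * dderiv a * b + a * (q * dderiv b)) (a' * b + a * b')"
      using ab * by (intro cong_add cong_mult cong_refl vars_V_X) auto
    then have "cong (q * dderiv (a * b)) (a' * b + a * b')"
      by (simp add: dderiv_mult algebra_simps)
    moreover have "vars (a' * b + a * b') \<subseteq> V" "vars (a * b) \<subseteq> V"
      using ab * by (simp_all add: vars_add_subset vars_mult_subset)
    ultimately show "a * b \<in> ?S" by blast
  next
    fix c
    have "vars (q * dderiv (Const c)) \<subseteq> V"
      by (simp add: dderiv_Const vars_mult_subset vars_q)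
    then show "Const c \<in> ?S"
      using cong_refl[OF vars_V_X] by auto
  next
    fix v assume "v \<in> vars f"
    with assms have v: "v \<in> V" by blast
    then obtain g where g: "vars g \<subseteq> V" "q * Var (succ_var v) - g \<in> J"
      using deriv_V by blast
    have "succ_var v \<in> X" using v V_X succ_X by blast
    then have "vars (q * Var (succ_var v)) \<subseteq> X"
      by (simp add: vars_mult_subset vars_V_X vars_q)
    with g have "cong (q * dderiv (Var v)) g"
      by (cases v) (simp add: cong_def vars_V_X dderiv_Var succ_var_def)
    with g v show "Var v \<in> ?S" by auto
  qed
  then show ?thesis by blast
qed

text \<open>Induction on \<open>j\<close>: the congruence for one derivative is differentiated, and
  the new derivatives of \<open>b\<close> and of \<open>q ^ k\<close> are brought back to
  polynomials over \<open>V\<close> by \<open>ex_cong_dderiv\<close>.\<close>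

lemma ex_cong_funpow_dderiv:
  assumes "vars w \<subseteq> X" "vars b \<subseteq> V" "cong (q * w) b"
  shows "\<exists>k b. vars b \<subseteq> V \<and> cong (q ^ k * (dderiv ^^ j) w) b"
proof (induction j)
  case 0
  show ?case using assms by (intro exI[of _ 1] exI[of _ b]) simp
next
  case (Suc j)
  define d where "d = (dderiv ^^ j) w"
  from Suc obtain k b where b: "vars b \<subseteq> V" "cong (q ^ k * d) b"
    by (auto simp: d_def)
  have qk: "vars (q ^ k) \<subseteq> V" for k by (simp add: vars_power_subset vars_q)
  obtain h where h: "vars h \<subseteq> V" "cong (q * dderiv (q ^ k)) h"
    using ex_cong_dderiv[OF qk] by blast
  obtain g where g: "vars g \<subseteq> V" "cong (q * dderiv b) g"
    using ex_cong_dderiv[OF b(1)] by blast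
  \<comment> \<open>The product rule for \<open>q ^ k * d\<close>, multiplied by
    \<open>q ^ Suc k\<close> and solved for the term with \<open>dderiv d\<close>. That multiplier
    turns the unwanted term into a multiple of \<open>q ^ k * d\<close>, which is already reduced;
    the exponent grows from \<open>k\<close> to \<open>2 * k + 1\<close>.\<close>
  have "q ^ Suc (2 * k) * dderiv d = q ^ Suc k * dderiv (q ^ k * d) - q * dderiv (q ^ k) * (q ^ k * d)"
    by (simp only: power_Suc mult_2 power_add dderiv_mult) (simp add: algebra_simps)
  also have "cong \<dots> (q ^ Suc k * dderiv b - h * b)"
    by (intro cong_diff cong_mult cong_dderiv b h cong_refl vars_V_X[OF qk])
  also have "q ^ Suc k * dderiv b - h * b = q ^ k * (q * dderiv b) - h * b"
    by (simp add: algebra_simps)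
  also have "cong \<dots> (q ^ k * g - h * b)"
    using g b h by (intro cong_diff cong_mult cong_refl vars_V_X qk)
  finally have "cong (q ^ Suc (2 * k) * (dderiv ^^ Suc j) w) (q ^ k * g - h * b)"
    by (simp add: d_def)
  moreover have "vars (q ^ k * g - h * b) \<subseteq> V"
    using g b h qk by (intro vars_diff_subset vars_mult_subset)
  ultimately show ?case by blast
qed

text \<open>The \<open>card V + 1\<close> derivatives of \<open>i\<close> of order at most
  \<open>card V\<close> become polynomials in \<open>card V\<close> variables over a common
  denominator, hence satisfy an algebraic relation. Read in the derivatives themselves, it is the
  required \<open>f\<close>, which may turn out to be a constant.\<close>

lemma ex_elimination:
  assumes "finite V" and X: "{i} \<times> UNIV \<subseteq> X" and b: "vars b \<subseteq> V" "cong (q * Var (i, 0)) b"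
  shows "\<exists>f L. f \<noteq> 0 \<and> vars f \<subseteq> {i} \<times> {..card V} \<and> q ^ L * f \<in> J"
proof -
  have Var_X: "vars (Var (i, j)) \<subseteq> X" for j using X by auto
  have "\<exists>k b. vars b \<subseteq> V \<and> cong (q ^ k * Var (i, j)) b" for j
    using ex_cong_funpow_dderiv[OF Var_X b, of j] by (simp add: dderiv_funpow_Var)
  then obtain k c where c: "\<And>j. vars (c j) \<subseteq> V" "\<And>j. cong (q ^ k j * Var (i, j)) (c j)"
    by metis
  \<comment> \<open>The sum bounds every \<open>k j\<close>, so \<open>h = q ^ K\<close> is a common
    denominator of all the derivatives considered.\<close>
  define K where "K = (\<Sum>j\<le>card V. k j)"
  define h where "h = q ^ K"
  define g where "g = (\<lambda>v :: 'i \<times> nat. q ^ (K - k (snd v)) * c (snd v))"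
  define I where "I = {i} \<times> {..card V}"
  have vars_h: "vars h \<subseteq> V" by (simp add: h_def vars_power_subset vars_q)
  have vars_g: "vars (g v) \<subseteq> V" for v
    by (simp add: g_def vars_mult_subset vars_power_subset vars_q c)
  have cong_g: "cong (h * Var v) (g v)" if "v \<in> I" for v
  proof -
    obtain j where v: "v = (i, j)" and "j \<le> card V" using \<open>v \<in> I\<close> by (auto simp: I_def)
    then have "k j \<le> K" unfolding K_def by (intro member_le_sum) auto
    then have "h * Var v = q ^ (K - k j) * (q ^ k j * Var v)"
      by (simp add: h_def mult.assoc[symmetric] flip: power_add)
    also have "cong \<dots> (q ^ (K - k j) * c j)"
      unfolding v by (intro cong_mult cong_refl c vars_V_X vars_power_subset vars_q)
    finally show ?thesis by (simp add: g_def v)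
  qed
  have I: "finite I" "card V < card I" by (simp_all add: I_def card_cartesian_product)
  obtain P :: "('i, 'k) dpoly" and L where P: "P \<noteq> 0" "vars P \<subseteq> I"
    and deg: "\<And>e. e \<in> Poly_Mapping.keys P \<Longrightarrow> (\<Sum>v\<in>I. Poly_Mapping.lookup e v) \<le> L"
    and rel: "(\<Sum>e\<in>Poly_Mapping.keys P. Const (Poly_Mapping.lookup P e) *
      (h ^ (L - (\<Sum>v\<in>I. Poly_Mapping.lookup e v)) * (\<Prod>v\<in>I. g v ^ Poly_Mapping.lookup e v))) = 0"
    by (rule algebraic_relation[where g = g, OF \<open>finite V\<close> I vars_h vars_g]) (rule that; assumption)
  \<comment> \<open>Each variable of a monomial takes one factor \<open>h\<close> out of
    \<open>h ^ L\<close>; the rest is the power of \<open>h\<close> that occurs in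
    \<open>rel\<close>.\<close>
  have monomial: "h ^ L * (\<Prod>v\<in>Poly_Mapping.keys e. Var v ^ Poly_Mapping.lookup e v) =
      h ^ (L - (\<Sum>v\<in>I. Poly_Mapping.lookup e v)) * (\<Prod>v\<in>I. (h * Var v) ^ Poly_Mapping.lookup e v)"
    if e: "e \<in> Poly_Mapping.keys P" for e
  proof -
    have "Poly_Mapping.keys e \<subseteq> I" using e P(2) by (auto simp: vars_def)
    then have "(\<Prod>v\<in>Poly_Mapping.keys e. Var v ^ Poly_Mapping.lookup e v) =
        (\<Prod>v\<in>I. (Var v :: ('i, 'k) dpoly) ^ Poly_Mapping.lookup e v)"
      using I(1) by (intro prod.mono_neutral_left) (simp_all add: in_keys_iff)
    moreover have "h ^ L = h ^ (L - (\<Sum>v\<in>I. Poly_Mapping.lookup e v)) * (\<Prod>v\<in>I. h ^ Poly_Mapping.lookup e v)"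
      using deg[OF e] by (simp flip: power_sum power_add)
    ultimately show ?thesis
      by (simp add: power_mult_distrib prod.distrib mult_ac)
  qed
  have "h ^ L * P = (\<Sum>e\<in>Poly_Mapping.keys P. Const (Poly_Mapping.lookup P e) *
      (h ^ L * (\<Prod>v\<in>Poly_Mapping.keys e. Var v ^ Poly_Mapping.lookup e v)))"
    by (subst mpoly_eq_sum_monomials[of P]) (simp add: sum_distrib_left mult_ac)
  also have "\<dots> = (\<Sum>e\<in>Poly_Mapping.keys P. Const (Poly_Mapping.lookup P e) *
      (h ^ (L - (\<Sum>v\<in>I. Poly_Mapping.lookup e v)) * (\<Prod>v\<in>I. (h * Var v) ^ Poly_Mapping.lookup e v)))"
    by (simp add: monomial)
  also have "cong \<dots> (\<Sum>e\<in>Poly_Mapping.keys P. Const (Poly_Mapping.lookup P e) *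
      (h ^ (L - (\<Sum>v\<in>I. Poly_Mapping.lookup e v)) * (\<Prod>v\<in>I. g v ^ Poly_Mapping.lookup e v)))"
    by (intro cong_sum cong_mult cong_prod cong_power cong_g cong_refl vars_V_X vars_power_subset vars_h) auto
  finally have "h ^ L * P \<in> J"
    unfolding rel by (simp add: cong_def)
  then have "q ^ (K * L) * P \<in> J"
    by (simp add: h_def power_mult)
  with P show ?thesis unfolding I_def by blast
qed

end

section \<open>Closure properties of generated ideals\<close>

lemma ideal_gen_zero: "0 \<in> ideal_gen R S"
  unfolding ideal_gen_def by (intro CollectI exI[of _ "\<lambda>_. 0"] exI[of _ "{}"]) simp

lemma ideal_gen_superset: "1 \<in> R \<Longrightarrow> s \<in> S \<Longrightarrow> s \<in> ideal_gen R S"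
  unfolding ideal_gen_def by (intro CollectI exI[of _ "\<lambda>_. 1"] exI[of _ "{s}"]) simp

lemma ideal_gen_mult:
  assumes "\<And>a b. a \<in> R \<Longrightarrow> b \<in> R \<Longrightarrow> a * b \<in> R" "r \<in> R" "f \<in> ideal_gen R S"
  shows "r * f \<in> ideal_gen R S"
proof -
  from assms(3) obtain c T where c: "f = (\<Sum>s\<in>T. c s * s)" "finite T" "T \<subseteq> S" "c ` T \<subseteq> R"
    by (auto simp: ideal_gen_def)
  have "r * f = (\<Sum>s\<in>T. (r * c s) * s)" by (simp add: c(1) sum_distrib_left mult.assoc)
  moreover have "(\<lambda>s. r * c s) ` T \<subseteq> R" using c(4) assms(1,2) by blast
  ultimately show ?thesis
    using c(2,3) unfolding ideal_gen_def by (intro CollectI exI conjI)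
qed

lemma ideal_gen_add:
  assumes "0 \<in> R" "\<And>a b. a \<in> R \<Longrightarrow> b \<in> R \<Longrightarrow> a + b \<in> R"
    and "f \<in> ideal_gen R S" "g \<in> ideal_gen R S"
  shows "f + g \<in> ideal_gen R S"
proof -
  from assms(3) obtain c T where c: "f = (\<Sum>s\<in>T. c s * s)" "finite T" "T \<subseteq> S" "c ` T \<subseteq> R"
    by (auto simp: ideal_gen_def)
  from assms(4) obtain d U where d: "g = (\<Sum>s\<in>U. d s * s)" "finite U" "U \<subseteq> S" "d ` U \<subseteq> R"
    by (auto simp: ideal_gen_def)
  \<comment> \<open>The two combinations may use different generators; padding both with coefficient
    0 puts them over \<open>T \<union> U\<close>.\<close>
  define e where "e = (\<lambda>s. (if s \<in> T then c s else 0) + (if s \<in> U then d s else 0))"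
  have "f = (\<Sum>s\<in>T \<union> U. (if s \<in> T then c s else 0) * s)"
    unfolding c(1) using c(2) d(2) by (intro sum.mono_neutral_cong_left) auto
  moreover have "g = (\<Sum>s\<in>T \<union> U. (if s \<in> U then d s else 0) * s)"
    unfolding d(1) using c(2) d(2) by (intro sum.mono_neutral_cong_left) auto
  ultimately have "f + g = (\<Sum>s\<in>T \<union> U. e s * s)"
    by (simp add: e_def distrib_right sum.distrib)
  moreover have "e ` (T \<union> U) \<subseteq> R"
    unfolding e_def using c(4) d(4) by (intro image_subsetI assms(2)) (auto intro: assms(1))
  moreover have "finite (T \<union> U)" "T \<union> U \<subseteq> S" using c d by auto
  ultimately show ?thesis
    unfolding ideal_gen_def by (intro CollectI exI conjI)
qed

text \<open>The derivative of \<open>c s * s\<close> is a combination of \<open>s\<close> and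
  \<open>dderiv s\<close>, and the generating set contains the derivative of each of its
  elements.\<close>

lemma dderiv_diff_ideal_gen:
  assumes R: "0 \<in> R" "1 \<in> R" "\<And>a b. a \<in> R \<Longrightarrow> b \<in> R \<Longrightarrow> a + b \<in> R"
      "\<And>a b. a \<in> R \<Longrightarrow> b \<in> R \<Longrightarrow> a * b \<in> R" "\<And>a. a \<in> R \<Longrightarrow> dderiv a \<in> R"
    and f: "f \<in> diff_ideal_gen R S"
  shows "dderiv f \<in> diff_ideal_gen R S"
proof -
  let ?D = "{(dderiv ^^ k) s | k s. s \<in> S}"
  from f obtain c T where c: "f = (\<Sum>s\<in>T. c s * s)" "finite T" "T \<subseteq> ?D" "c ` T \<subseteq> R"
    by (auto simp: diff_ideal_gen_def ideal_gen_def)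
  have "dderiv s \<in> ?D" if "s \<in> ?D" for s
  proof -
    from that obtain k s0 where "s = (dderiv ^^ k) s0" "s0 \<in> S" by blast
    then have "dderiv s = (dderiv ^^ Suc k) s0" by simp
    with \<open>s0 \<in> S\<close> show ?thesis by blast
  qed
  moreover have "s \<in> ?D" "c s \<in> R" if "s \<in> T" for s
    using c(3,4) that by blast+
  ultimately have summand: "dderiv (c s * s) \<in> ideal_gen R ?D" if "s \<in> T" for s
    unfolding dderiv_mult using that
    by (intro ideal_gen_add[OF R(1,3)] ideal_gen_mult[OF R(4)] ideal_gen_superset[OF R(2)] R(5)) simp_all
  have "(\<Sum>s\<in>A. dderiv (c s * s)) \<in> ideal_gen R ?D" if "A \<subseteq> T" for A
    using finite_subset[OF that c(2)] that
    by (induction A) (auto intro: ideal_gen_zero ideal_gen_add[OF R(1,3)] summand)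
  then show ?thesis
    by (simp add: c(1) dderiv_sum diff_ideal_gen_def)
qed

section \<open>The order bound for an arbitrary model\<close>

lemma min_order_le_states:
  fixes M :: "'k::field_char_0 model"
  assumes "common_denominator M Q"
  shows "min_order M Q \<le> enat (states M)"
proof -
  define N where "N = states M"
  \<comment> \<open>\<open>V\<close> contains the states without their derivatives, so its size is
    the number of states; \<open>X\<close> contains all variables of the model ring. The generators
    for the state equations reduce the first derivatives of \<open>V\<close>.\<close>
  define V where "V = U ` {..<N} \<times> {0::nat}"
  define X where "X = (U ` {..<N} \<union> {W}) \<times> (UNIV :: nat set)"
  define q :: "(indet, 'k) dpoly" where "q = state_poly Q"
  define S where "S = {state_poly Q * Var (U i, 1) - state_poly a | i a. i < states M \<and> rhs M i = Fract a Q} \<union>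
    {state_poly Q * Var (W, 0) - state_poly b | b. out M = Fract b Q}"
  define J where "J = diff_ideal_gen (model_ring M) S"
  have R: "f \<in> model_ring M \<longleftrightarrow> vars f \<subseteq> X" for f
    by (simp add: model_ring_def X_def N_def)
  have succ_X: "succ_var v \<in> X" if "v \<in> X" for v using that by (auto simp: X_def succ_var_def)
  have W_X: "(W, j) \<in> X" for j by (simp add: X_def)
  have R_dderiv: "dderiv f \<in> model_ring M" if "f \<in> model_ring M" for f
    using that vars_dderiv[of f] succ_X unfolding R by blast
  have gen: "s \<in> J" if "s \<in> S" for s
  proof -
    have "(dderiv ^^ 0) s \<in> {(dderiv ^^ k) s | k s. s \<in> S}" using that by blast
    then show ?thesis unfolding J_def diff_ideal_gen_def
      by (intro ideal_gen_superset) (simp_all add: R)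
  qed
  have mult_J: "f * g \<in> J" if "vars f \<subseteq> X" "g \<in> J" for f g
    using that unfolding J_def diff_ideal_gen_def by (intro ideal_gen_mult) (simp_all add: R vars_mult_subset)
  interpret dderiv_congruence X V J q
  proof
    show "dderiv f \<in> J" if "f \<in> J" for f
      using that R_dderiv unfolding J_def
      by (intro dderiv_diff_ideal_gen) (simp_all add: R vars_add_subset vars_mult_subset)
    show "f + g \<in> J" if "f \<in> J" "g \<in> J" for f g
      using that unfolding J_def diff_ideal_gen_def
      by (intro ideal_gen_add) (simp_all add: R vars_add_subset)
    show "0 \<in> J" by (simp add: J_def diff_ideal_gen_def ideal_gen_zero)
    show "vars q \<subseteq> V"
      using assms unfolding q_def V_def N_def
      by (intro vars_state_poly) (simp add: common_denominator_def)
    show "\<exists>g. vars g \<subseteq> V \<and> q * Var (succ_var v) - g \<in> J" if "v \<in> V" for v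
    proof -
      from that obtain i where v: "v = (U i, 0)" and i: "i < states M" by (auto simp: V_def N_def)
      with assms obtain a where a: "vars a \<subseteq> {..<states M}" "rhs M i = Fract a Q"
        unfolding common_denominator_def by blast
      then have "q * Var (succ_var v) - state_poly a \<in> S"
        using i by (auto simp: S_def q_def v succ_var_def)
      then show ?thesis
        using gen vars_state_poly[OF a(1)] by (auto simp: V_def N_def)
    qed
  qed (use succ_X mult_J in \<open>auto simp: X_def V_def\<close>)
  obtain b where b: "vars b \<subseteq> {..<states M}" "out M = Fract b Q"
    using assms by (auto simp: common_denominator_def)
  have vb: "vars (state_poly b) \<subseteq> V"
    using vars_state_poly[OF b(1)] by (simp add: V_def N_def)
  \<comment> \<open>The generator for the output equation starts the reduction of the derivatives of
    \<open>w\<close>.\<close>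
  have "q * Var (W, 0) - state_poly b \<in> J"
    using b(2) by (intro gen) (auto simp: S_def q_def)
  then have "cong (q * Var (W, 0)) (state_poly b)"
    using vars_V_X[OF vars_q] vars_V_X[OF vb]
    by (simp add: cong_def vars_mult_subset W_X)
  moreover have "finite V" "{W} \<times> UNIV \<subseteq> X" by (auto simp: V_def X_def)
  ultimately obtain f L where f: "f \<noteq> 0" "vars f \<subseteq> {W} \<times> {..card V}" "q ^ L * f \<in> J"
    using ex_elimination vb by blast
  have "card V = N"
    by (simp add: V_def card_cartesian_product card_image inj_on_def)
  with f(2) have vf: "vars f \<subseteq> {W} \<times> {..N}" by simp
  have ideal: "g \<in> model_ideal M Q \<longleftrightarrow> vars g \<subseteq> X \<and> (\<exists>k. q ^ k * g \<in> J)" for g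
    by (simp add: model_ideal_def saturation_def R J_def S_def q_def)
  have "\<exists>g k. g \<in> model_ideal M Q \<inter> w_ring \<and> g \<noteq> 0 \<and> has_order W g k \<and> k \<le> N"
  proof (cases "vars f = {}")
    case True
    \<comment> \<open>A non-zero constant has no order, but then every multiple of \<open>w\<close> is in the ideal as well.\<close>
    define c where "c = Poly_Mapping.lookup f 0"
    have "Poly_Mapping.keys f \<subseteq> {0}"
      using True by (auto simp: vars_def)
    then have fc: "f = Const c"
      by (intro poly_mapping_eqI) (auto simp: Const_def c_def lookup_single when_def in_keys_iff)
    then have "c \<noteq> 0" using f(1) by (auto simp: Const_def)
    then have "Const (1 / c) * Const c = (1 :: (indet, 'k) dpoly)"
      by (simp add: Const_1 flip: Const_mult)
    then have "q ^ L * Var (W, 0) = Var (W, 0) * q ^ L * (Const (1 / c) * Const c)"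
      by simp
    also have "\<dots> = Var (W, 0) * Const (1 / c) * (q ^ L * f)"
      by (simp only: fc mult_ac)
    also have "\<dots> \<in> J"
      by (intro mult_J f(3) vars_mult_subset) (auto simp: X_def)
    finally have "Var (W, 0) \<in> model_ideal M Q"
      unfolding ideal by (auto simp: X_def)
    moreover have "has_order W (Var (W, 0) :: (indet, 'k) dpoly) 0" by (simp add: has_order_def)
    moreover have "Var (W, 0) \<noteq> (0 :: (indet, 'k) dpoly)"
      using vars_Var[of "(W, 0)"] vars_zero by (metis insert_not_empty)
    ultimately show ?thesis
      by (intro exI[of _ "Var (W, 0)"] exI[of _ 0]) (simp add: w_ring_def)
  next
    case False
    define k where "k = Max (snd ` vars f)"
    have fin: "finite (snd ` vars f)" using vf finite_subset by fastforce
    then have "k \<in> snd ` vars f" unfolding k_def using False by (intro Max_in) auto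
    then have "(W, k) \<in> vars f" "k \<le> N" using vf by auto
    moreover have "j \<le> k" if "(W, j) \<in> vars f" for j
      unfolding k_def using that fin by (intro Max_ge) force+
    ultimately have "has_order W f k" by (simp add: has_order_def)
    moreover have "f \<in> model_ideal M Q \<inter> w_ring"
      using vf f(3) by (auto simp: ideal w_ring_def X_def)
    ultimately show ?thesis using f(1) \<open>k \<le> N\<close> by blast
  qed
  then obtain g k where "g \<in> model_ideal M Q \<inter> w_ring" "g \<noteq> 0" "has_order W g k" "k \<le> N"
    by blast
  then have "min_order M Q \<le> enat k"
    unfolding min_order_def by (intro Inf_lower) blast
  also have "\<dots> \<le> enat (states M)" using \<open>k \<le> N\<close> by (simp add: N_def)
  finally show ?thesis .
qed

section \<open>Orders of derivatives and of the model built from \<open>p\<close> and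
  \<open>q\<close>\<close>

lemma dorder_eq: "has_order i f n \<Longrightarrow> dorder i f = n"
  unfolding dorder_def has_order_def by (rule the_equality) (auto intro: antisym)

text \<open>Characteristic 0 ensures that the exponent brought down by differentiating a power does
  not vanish.\<close>

lemma of_nat_ratx_eq_0_iff: "(of_nat n :: 'k::field_char_0 ratx) = 0 \<longleftrightarrow> n = 0"
  by (simp add: of_nat_fract Zero_fract_def eq_fract)

lemma has_order_dderiv:
  fixes f :: "('i, 'k::field_char_0) dpoly"
  assumes f: "has_order i f n"
  shows "has_order i (dderiv f) (Suc n)"
proof -
  let ?v = "(i, n)" and ?w = "(i, Suc n)"
  have w: "Poly_Mapping.lookup t ?w = 0" if "t \<in> Poly_Mapping.keys f" for t
  proof -
    have "?w \<notin> vars f" using f by (auto simp: has_order_def)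
    with that show ?thesis by (auto simp: vars_def in_keys_iff)
  qed
  obtain t where t: "t \<in> Poly_Mapping.keys f" "Poly_Mapping.lookup t ?v \<noteq> 0"
    using f by (auto simp: has_order_def vars_def in_keys_iff)
  let ?m = "\<lambda>t u. t - Poly_Mapping.single u 1 + Poly_Mapping.single (succ_var u) (1::nat)"
  \<comment> \<open>The monomial \<open>s\<close> of \<open>dderiv f\<close> arises only from \<open>t\<close>, by differentiating \<open>(i, n)\<close>, so its
    coefficient does not cancel.\<close>
  define s where "s = ?m t ?v"
  have s_w: "Poly_Mapping.lookup s ?w = 1"
    using w[OF t(1)] by (simp add: s_def lookup_add lookup_minus lookup_single succ_var_def)
  have s_iff: "?m t' u = s \<longleftrightarrow> t' = t \<and> u = ?v"
    if t': "t' \<in> Poly_Mapping.keys f" "u \<in> Poly_Mapping.keys t'" for t' u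
  proof
    assume eq: "?m t' u = s"
    \<comment> \<open>Only differentiating \<open>(i, n)\<close> creates \<open>(i, Suc n)\<close>,
      which no monomial of \<open>f\<close> contains.\<close>
    have u: "u = ?v"
    proof (rule ccontr)
      assume "u \<noteq> ?v"
      then have "succ_var u \<noteq> ?w" by (cases u) (auto simp: succ_var_def)
      then have "Poly_Mapping.lookup (?m t' u) ?w = 0"
        using w[OF t'(1)] by (simp add: lookup_add lookup_minus lookup_single)
      with eq s_w show False by simp
    qed
    \<comment> \<open>Subtraction of exponents is truncated; adding the variable back restores
      \<open>t'\<close> because the variable occurs in it.\<close>
    have "t' = t' - Poly_Mapping.single ?v 1 + Poly_Mapping.single ?v 1"
      using t'(2) unfolding u
      by (intro poly_mapping_eqI) (auto simp: lookup_add lookup_minus lookup_single when_def in_keys_iff)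
    also have "t' - Poly_Mapping.single ?v 1 = t - Poly_Mapping.single ?v 1"
      using eq unfolding u s_def by simp
    also have "t - Poly_Mapping.single ?v 1 + Poly_Mapping.single ?v 1 = t"
      using t(2) by (intro poly_mapping_eqI) (auto simp: lookup_add lookup_minus lookup_single when_def)
    finally show "t' = t \<and> u = ?v" using u by simp
  qed (simp add: s_def)
  have "Poly_Mapping.lookup (mderiv t' c) s = (if t' = t then of_nat (Poly_Mapping.lookup t ?v) * c else 0)"
    if t': "t' \<in> Poly_Mapping.keys f" for t' c
  proof -
    \<comment> \<open>Hence the summand of \<open>mderiv\<close> that differentiates the coefficient
      contributes nothing at \<open>s\<close>.\<close>
    have "t' \<noteq> s" using s_w w[OF t'] by auto
    then have "Poly_Mapping.lookup (mderiv t' c) s =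
        (\<Sum>u\<in>Poly_Mapping.keys t'. if t' = t \<and> u = ?v then of_nat (Poly_Mapping.lookup t' u) * c else 0)"
      unfolding mderiv_def lookup_add lookup_sum lookup_single when_def
      by (simp add: s_iff[OF t', unfolded One_nat_def] cong: sum.cong)
    also have "\<dots> = (if t' = t then of_nat (Poly_Mapping.lookup t ?v) * c else 0)"
      using t(2) by (auto simp: in_keys_iff)
    finally show ?thesis .
  qed
  then have "Poly_Mapping.lookup (dderiv f) s = (\<Sum>t'\<in>Poly_Mapping.keys f.
      if t' = t then of_nat (Poly_Mapping.lookup t ?v) * Poly_Mapping.lookup f t' else 0)"
    unfolding dderiv_def lookup_sum by (intro sum.cong refl)
  also have "\<dots> = of_nat (Poly_Mapping.lookup t ?v) * Poly_Mapping.lookup f t"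
    using t(1) by simp
  also have "\<dots> \<noteq> 0" using t by (simp add: of_nat_ratx_eq_0_iff in_keys_iff)
  finally have "s \<in> Poly_Mapping.keys (dderiv f)" by (simp add: in_keys_iff)
  moreover have "?w \<in> Poly_Mapping.keys s" using s_w by (simp add: in_keys_iff)
  ultimately have "?w \<in> vars (dderiv f)" by (auto simp: vars_def)
  moreover have "j \<le> Suc n" if "(i, j) \<in> vars (dderiv f)" for j
  proof -
    have "(i, j) \<in> vars f \<or> (\<exists>l. j = Suc l \<and> (i, l) \<in> vars f)"
      using that vars_dderiv[of f] by (auto simp: succ_var_def)
    then show ?thesis using f by (auto simp: has_order_def le_Suc_eq)
  qed
  ultimately show ?thesis by (simp add: has_order_def)
qed

lemma dorder_make_lho_le:
  fixes f :: "(unit, 'k::field_char_0) dpoly"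
  shows "has_order () f n \<Longrightarrow> dorder () (make_lho f) \<le> n + 1"
  using dorder_eq[of "()" f n] dorder_eq[OF has_order_dderiv[of "()" f n]] by (simp add: make_lho_def)

theorem corollary4p10:
  fixes F :: "'k::field_char_0 ratx set"
    and p q :: "(unit, 'k) dpoly"
    and n m :: nat
    and \<alpha> :: "'k ratfun \<Rightarrow> 'k ratfun \<Rightarrow> 'k ratfun"
    and Q :: "(nat, 'k ratx) mpoly"
  assumes "F = range (\<lambda>a. Fract a 1) \<or> F = UNIV"
    and "\<forall>t. Poly_Mapping.lookup p t \<in> F"
    and "\<forall>t. Poly_Mapping.lookup q t \<in> F"
    and "has_order () p n"
    and "has_order () q m"
    and "\<alpha> \<in> {(+), (-), (*), (/)}"
    and "arith_model_defined \<alpha> p q"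
    and "common_denominator (arith_model \<alpha> p q) Q"
  shows "min_order (arith_model \<alpha> p q) Q \<le> enat (m + n + 2)"
proof -
  \<comment> \<open>The states are the derivatives below the two orders; passing to
    \<open>make_lho\<close> raises each order by at most 1, which gives the 2 in the bound.\<close>
  have "states (arith_model \<alpha> p q) = dorder () (make_lho p) + dorder () (make_lho q)"
    by (simp add: arith_model_def Let_def)
  also have "\<dots> \<le> m + n + 2"
    using dorder_make_lho_le[OF assms(4)] dorder_make_lho_le[OF assms(5)] by simp
  finally show ?thesis
    using min_order_le_states[OF assms(8)] by (meson enat_ord_simps(1) order_trans)
qed

end
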